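(* Let $B$ be a central simple division algebra over a field $F$, let $\sigma\in\mathrm{Aut}_F(B)$ be a non-trivial automorphism and let $c\in B^{\times}$. (i) $D(B,\sigma,c)$ is a division algebra if and only if $c\neq rt^{-1}rs\,\sigma(s^{-1}t^{-1})$ for all $r,s,t\in B^{\times}$. (ii) $D_m(B,\sigma,c)$ is a division algebra if and only if $c\neq\sigma(t)^{-1}rt^{-1}rs\,\sigma(s)^{-1}$ for all $r,s,t\in B^{\times}$. (iii) $D_r(B,\sigma,c)$ is a division algebra if and only if $c\neq\sigma(s^{-1}t^{-1})rt^{-1}rs$ for all $r,s,t\in B^{\times}$.
   Context: $D(B,\sigma,c)$, $D_m(B,\sigma,c)$ and $D_r(B,\sigma,c)$ denote the $F$-vector space $B\oplus B$ endowed, respectively, with the multiplications $(u,v)(x,y)=(ux+c\,\sigma(vy),\,uy+vx)$, $(u,v)(x,y)=(ux+\sigma(v)c\,\sigma(y),\,uy+vx)$, $(u,v)(x,y)=(ux+\sigma(vy)c,\,uy+vx)$, for $u,v,x,y\in B$. These are unital nonassociative finite-dimensional $F$-algebras. A finite-dimensional (nonassociative) $F$-algebra $A$ is a division algebra if for every nonzero $a\in A$ the maps $x\mapsto ax$ and $x\mapsto xa$ are bijective; equivalently, $A$ has no zero divisors. *)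

theory Defs
  imports "HOL-Analysis.Product_Vector"
begin

text \<open>
  Finite-dimensional algebras over a field \<open>'f\<close>, neither associative nor unital in general. The
  underlying vector space is the whole type \<open>'a\<close>; the scalar action and the product are parameters.
\<close>

locale fd_algebra = vector_space smul
  for smul :: "'f::field \<Rightarrow> 'a::ab_group_add \<Rightarrow> 'a" +
  fixes mult :: "'a \<Rightarrow> 'a \<Rightarrow> 'a"
  assumes linear_mult_left: "Vector_Spaces.linear smul smul (\<lambda>x. mult a x)"
    and linear_mult_right: "Vector_Spaces.linear smul smul (\<lambda>x. mult x a)"
    and finite_dimensional: "\<exists>Basis. finite_dimensional_vector_space smul Basis"

locale division_algebra = fd_algebra smul mult
  for smul :: "'f::field \<Rightarrow> 'a::ab_group_add \<Rightarrow> 'a" and mult :: "'a \<Rightarrow> 'a \<Rightarrow> 'a" +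
  assumes bij_mult_left: "a \<noteq> 0 \<Longrightarrow> bij (\<lambda>x. mult a x)"
    and bij_mult_right: "a \<noteq> 0 \<Longrightarrow> bij (\<lambda>x. mult x a)"

text \<open>
  Associativity, the unit and \<open>1 \<noteq> 0\<close> come from the class \<open>ring_1\<close>. With the unit present, a
  two-sided ring ideal is automatically a subspace.
\<close>

locale central_simple_algebra = fd_algebra smul "(*)"
  for smul :: "'f::field \<Rightarrow> 'a::ring_1 \<Rightarrow> 'a" +
  assumes central: "{z. \<forall>x. z * x = x * z} = range (\<lambda>k. smul k 1)"
    and simple: "subspace I \<Longrightarrow> (\<And>a x. x \<in> I \<Longrightarrow> a * x \<in> I \<and> x * a \<in> I) \<Longrightarrow> I = {0} \<or> I = UNIV"

definition algebra_automorphism ::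
  "('f::field \<Rightarrow> 'a::ring_1 \<Rightarrow> 'a) \<Rightarrow> ('a \<Rightarrow> 'a) \<Rightarrow> bool" where
  "algebra_automorphism smul \<sigma> \<longleftrightarrow>
     Vector_Spaces.linear smul smul \<sigma> \<and> bij \<sigma> \<and> \<sigma> 1 = 1 \<and> (\<forall>x y. \<sigma> (x * y) = \<sigma> x * \<sigma> y)"

text \<open>
  Multiplications on \<open>B \<oplus> B\<close>, rendered as the type \<open>'b \<times> 'b\<close>; its vector space structure is the
  componentwise one, \<open>module_prod.scale smul smul\<close>.
\<close>

definition D_mult :: "('b::ring_1 \<Rightarrow> 'b) \<Rightarrow> 'b \<Rightarrow> 'b \<times> 'b \<Rightarrow> 'b \<times> 'b \<Rightarrow> 'b \<times> 'b" where
  "D_mult \<sigma> c = (\<lambda>(u, v) (x, y). (u * x + c * \<sigma> (v * y), u * y + v * x))"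

definition Dm_mult :: "('b::ring_1 \<Rightarrow> 'b) \<Rightarrow> 'b \<Rightarrow> 'b \<times> 'b \<Rightarrow> 'b \<times> 'b \<Rightarrow> 'b \<times> 'b" where
  "Dm_mult \<sigma> c = (\<lambda>(u, v) (x, y). (u * x + \<sigma> v * c * \<sigma> y, u * y + v * x))"

definition Dr_mult :: "('b::ring_1 \<Rightarrow> 'b) \<Rightarrow> 'b \<Rightarrow> 'b \<times> 'b \<Rightarrow> 'b \<times> 'b \<Rightarrow> 'b \<times> 'b" where
  "Dr_mult \<sigma> c = (\<lambda>(u, v) (x, y). (u * x + \<sigma> (v * y) * c, u * y + v * x))"

end

theory Submission
  imports Defs
begin

text \<open>
  All three products have the shape \<open>(u, v) (x, y) = (u x + \<phi> v y, u y + v x)\<close> for a bilinear \<open>\<phi>\<close>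
  without zero divisors. In finite dimension, division means absence of zero divisors. A product
  with a zero entry in one factor vanishes only trivially; if all four entries are
  nonzero, the second component gives \<open>x = - v\<inverse> u y\<close>, and the first becomes
  \<open>\<phi> v y = u v\<inverse> u y\<close>. Solving this equation for \<open>c\<close> yields the three conditions, with
  \<open>(r, s, t) = (u, y, v)\<close>.
\<close>

lemma (in fd_algebra) mult_smul:
  shows "mult (smul k x) y = smul k (mult x y)" and "mult x (smul k y) = smul k (mult x y)"
  using linear_mult_left[of x] linear_mult_right[of y] by (simp_all add: Vector_Spaces.linear_iff)

text \<open>An injective linear endomorphism of a finite-dimensional space is surjective, so it
  suffices that left and right multiplication by a nonzero element have trivial kernel.\<close>

lemma (in fd_algebra) division_algebra_iff_no_zero_divisors:
  "division_algebra smul mult \<longleftrightarrow> (\<forall>a b. mult a b = 0 \<longrightarrow> a = 0 \<or> b = 0)"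
proof
  assume "division_algebra smul mult"
  then interpret division_algebra smul mult .
  show "\<forall>a b. mult a b = 0 \<longrightarrow> a = 0 \<or> b = 0"
  proof (intro allI impI)
    fix a b assume ab: "mult a b = 0"
    interpret l: Vector_Spaces.linear smul smul "mult a" by (rule linear_mult_left)
    show "a = 0 \<or> b = 0"
      using bij_is_inj[OF bij_mult_left] ab l.zero by (metis injD)
  qed
next
  assume nzd: "\<forall>a b. mult a b = 0 \<longrightarrow> a = 0 \<or> b = 0"
  obtain Basis where "finite_dimensional_vector_space smul Basis"
    using finite_dimensional by blast
  then interpret fin: finite_dimensional_vector_space smul Basis .
  have bij: "bij f" if lin: "Vector_Spaces.linear smul smul f" and ker: "\<And>x. f x = 0 \<Longrightarrow> x = 0" for f
  proof -
    interpret f: Vector_Spaces.linear smul smul f by (rule lin)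
    have "inj f"
      using ker f.inj_iff_eq_0 by blast
    then show ?thesis
      using fin.linear_inj_imp_surj[OF lin] by (simp add: bij_def)
  qed
  show "division_algebra smul mult"
  proof unfold_locales
    fix a :: 'a
    assume "a \<noteq> 0"
    then show "bij (\<lambda>x. mult a x)" "bij (\<lambda>x. mult x a)"
      using nzd by (auto intro!: bij linear_mult_left linear_mult_right)
  qed
qed

definition doubling_mult :: "('b::ring_1 \<Rightarrow> 'b \<Rightarrow> 'b) \<Rightarrow> 'b \<times> 'b \<Rightarrow> 'b \<times> 'b \<Rightarrow> 'b \<times> 'b" where
  "doubling_mult \<phi> = (\<lambda>(u, v) (x, y). (u * x + \<phi> v y, u * y + v * x))"

lemma doubling_mult_eq_0_cases:
  fixes \<phi> :: "'b::division_ring \<Rightarrow> 'b \<Rightarrow> 'b"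
  assumes zero_iff: "\<And>v y. \<phi> v y = 0 \<longleftrightarrow> v = 0 \<or> y = 0"
    and prod0: "doubling_mult \<phi> (u, v) (x, y) = 0"
    and nz: "(u, v) \<noteq> 0" "(x, y) \<noteq> 0"
  shows "u \<noteq> 0 \<and> y \<noteq> 0 \<and> v \<noteq> 0 \<and> \<phi> v y = u * inverse v * u * y"
proof -
  have e1: "u * x + \<phi> v y = 0" and e2: "u * y + v * x = 0"
    using prod0 by (simp_all add: doubling_mult_def zero_prod_def)
  \<comment> \<open>The order matters. If \<open>v = 0\<close>, then
    \<open>u * x = u * y = 0\<close> with \<open>u\<close> nonzero kills the second factor. If then
    \<open>y = 0\<close>, \<open>e2\<close> becomes \<open>v * x = 0\<close> and kills it again.
    Finally \<open>u = 0\<close> would turn \<open>e1\<close> into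
    \<open>\<phi> v y = 0\<close>.\<close>
  have "v \<noteq> 0"
    using e1 e2 nz zero_iff[of v y] by (auto simp: zero_prod_def)
  have "y \<noteq> 0"
    using e2 nz \<open>v \<noteq> 0\<close> zero_iff[of v y] by (auto simp: zero_prod_def)
  have "u \<noteq> 0"
    using e1 \<open>v \<noteq> 0\<close> \<open>y \<noteq> 0\<close> zero_iff[of v y] by auto
  have "x = - (inverse v * (u * y))"
    using e2 \<open>v \<noteq> 0\<close> by (simp add: add_eq_0_iff2 flip: mult.assoc)
  then have "\<phi> v y = u * inverse v * u * y"
    using e1 by (simp add: mult.assoc)
  then show ?thesis
    using \<open>u \<noteq> 0\<close> \<open>v \<noteq> 0\<close> \<open>y \<noteq> 0\<close> by blast
qed

text \<open>Zero divisors and solutions of the equation correspond: a solution is completed to a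
  vanishing product, and a vanishing product of nonzero pairs is a solution with
  \<open>(r, s, t) = (u, y, v)\<close>.\<close>

lemma doubling_no_zero_divisors_iff:
  fixes \<phi> :: "'b::division_ring \<Rightarrow> 'b \<Rightarrow> 'b"
  assumes zero_iff: "\<And>v y. \<phi> v y = 0 \<longleftrightarrow> v = 0 \<or> y = 0"
  shows "(\<forall>a b. doubling_mult \<phi> a b = 0 \<longrightarrow> a = 0 \<or> b = 0) \<longleftrightarrow>
    (\<forall>r s t. r \<noteq> 0 \<and> s \<noteq> 0 \<and> t \<noteq> 0 \<longrightarrow> \<phi> t s \<noteq> r * inverse t * r * s)"
proof (intro iffI allI impI notI)
  fix r s t
  assume nzd: "\<forall>a b. doubling_mult \<phi> a b = 0 \<longrightarrow> a = 0 \<or> b = 0"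
    and nz: "r \<noteq> 0 \<and> s \<noteq> 0 \<and> t \<noteq> 0" and eq: "\<phi> t s = r * inverse t * r * s"
  have "t * (inverse t * (r * s)) = r * s"
    using nz by (simp flip: mult.assoc)
  \<comment> \<open>The entry \<open>- (inverse t * (r * s))\<close> is the only one that makes the
    second component \<open>r * s + t * x\<close> vanish; \<open>eq\<close> is then exactly the
    vanishing of the first.\<close>
  then have "doubling_mult \<phi> (r, t) (- (inverse t * (r * s)), s) = 0"
    using eq by (simp add: doubling_mult_def zero_prod_def mult.assoc)
  then have "(r, t) = 0 \<or> (- (inverse t * (r * s)), s) = 0"
    using nzd by blast
  then show False
    using nz by (simp add: zero_prod_def)
next
  fix a b
  assume no_sol: "\<forall>r s t. r \<noteq> 0 \<and> s \<noteq> 0 \<and> t \<noteq> 0 \<longrightarrow> \<phi> t s \<noteq> r * inverse t * r * s"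
    and prod0: "doubling_mult \<phi> a b = 0"
  obtain u v x y where ab: "a = (u, v)" "b = (x, y)"
    by (cases a, cases b)
  show "a = 0 \<or> b = 0"
    using doubling_mult_eq_0_cases[OF zero_iff prod0[unfolded ab]] no_sol unfolding ab by blast
qed

lemma doubling_fd_algebra:
  fixes smul :: "'f::field \<Rightarrow> 'b::ring_1 \<Rightarrow> 'b"
  assumes "fd_algebra smul (*)"
    and add_left: "\<And>v w y. \<phi> (v + w) y = \<phi> v y + \<phi> w y"
    and add_right: "\<And>v y z. \<phi> v (y + z) = \<phi> v y + \<phi> v z"
    and smul_left: "\<And>k v y. \<phi> (smul k v) y = smul k (\<phi> v y)"
    and smul_right: "\<And>k v y. \<phi> v (smul k y) = smul k (\<phi> v y)"
  shows "fd_algebra (module_prod.scale smul smul) (doubling_mult \<phi>)"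
proof -
  interpret B: fd_algebra smul "(*)" by fact
  obtain Basis where "finite_dimensional_vector_space smul Basis"
    using B.finite_dimensional by blast
  then interpret fin: finite_dimensional_vector_space smul Basis .
  \<comment> \<open>Two copies of \<open>Basis\<close> give a finite basis of the direct
    sum.\<close>
  interpret P: finite_dimensional_vector_space_prod smul smul Basis Basis ..
  show ?thesis
  proof unfold_locales
    show "\<exists>Basis. finite_dimensional_vector_space (module_prod.scale smul smul) Basis"
      using P.p.finite_dimensional_vector_space_axioms by blast
  qed (auto simp: doubling_mult_def P.scale_prod add_left add_right smul_left smul_right B.mult_smul
      distrib_left distrib_right B.scale_right_distrib)
qed

lemma doubling_division_algebra_iff:
  fixes smul :: "'f::field \<Rightarrow> 'b::division_ring \<Rightarrow> 'b"
  assumes "fd_algebra smul (*)"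
    and "\<And>v w y. \<phi> (v + w) y = \<phi> v y + \<phi> w y"
    and "\<And>v y z. \<phi> v (y + z) = \<phi> v y + \<phi> v z"
    and "\<And>k v y. \<phi> (smul k v) y = smul k (\<phi> v y)"
    and "\<And>k v y. \<phi> v (smul k y) = smul k (\<phi> v y)"
    and "\<And>v y. \<phi> v y = 0 \<longleftrightarrow> v = 0 \<or> y = 0"
  shows "division_algebra (module_prod.scale smul smul) (doubling_mult \<phi>) \<longleftrightarrow>
    (\<forall>r s t. r \<noteq> 0 \<and> s \<noteq> 0 \<and> t \<noteq> 0 \<longrightarrow> \<phi> t s \<noteq> r * inverse t * r * s)"
proof -
  have "fd_algebra (module_prod.scale smul smul) (doubling_mult \<phi>)"
    by (rule doubling_fd_algebra[of smul \<phi>, OF assms(1-5)])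
  from fd_algebra.division_algebra_iff_no_zero_divisors[OF this] show ?thesis
    using doubling_no_zero_divisors_iff[of \<phi>, OF assms(6)] by (rule trans)
qed

text \<open>Serves to isolate \<open>c\<close> by cancelling nonzero factors on either side, which
  must be kept apart because the ring need not be commutative.\<close>

lemma mult_eq_iff_eq_mult_inverse:
  fixes a b c :: "'b::division_ring"
  shows "b \<noteq> 0 \<Longrightarrow> a * b = c \<longleftrightarrow> a = c * inverse b"
    and "b \<noteq> 0 \<Longrightarrow> b * a = c \<longleftrightarrow> a = inverse b * c"
proof -
  assume b: "b \<noteq> 0"
  show "a * b = c \<longleftrightarrow> a = c * inverse b"
    using b by (metis mult.assoc right_inverse left_inverse mult_1_right)
  show "b * a = c \<longleftrightarrow> a = inverse b * c"
    using b by (metis mult.assoc right_inverse left_inverse mult_1_left)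
qed

theorem theorem3p7:
  fixes smul :: "'f::field \<Rightarrow> 'b::division_ring \<Rightarrow> 'b"
    and \<sigma> :: "'b \<Rightarrow> 'b" and c :: 'b
  assumes "central_simple_algebra smul"
    and "algebra_automorphism smul \<sigma>" and "\<sigma> \<noteq> id"
    and "c \<noteq> 0"
  shows
    "(division_algebra (module_prod.scale smul smul) (D_mult \<sigma> c) \<longleftrightarrow>
        (\<forall>r s t. r \<noteq> 0 \<and> s \<noteq> 0 \<and> t \<noteq> 0 \<longrightarrow>
           c \<noteq> r * inverse t * r * s * \<sigma> (inverse s * inverse t))) \<and>
     (division_algebra (module_prod.scale smul smul) (Dm_mult \<sigma> c) \<longleftrightarrow>
        (\<forall>r s t. r \<noteq> 0 \<and> s \<noteq> 0 \<and> t \<noteq> 0 \<longrightarrow>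
           c \<noteq> inverse (\<sigma> t) * r * inverse t * r * s * inverse (\<sigma> s))) \<and>
     (division_algebra (module_prod.scale smul smul) (Dr_mult \<sigma> c) \<longleftrightarrow>
        (\<forall>r s t. r \<noteq> 0 \<and> s \<noteq> 0 \<and> t \<noteq> 0 \<longrightarrow>
           c \<noteq> \<sigma> (inverse s * inverse t) * r * inverse t * r * s))"
proof -
  interpret B: central_simple_algebra smul by fact
  have fd: "fd_algebra smul (*)" by (rule B.fd_algebra_axioms)
  have \<sigma>_add: "\<sigma> (x + y) = \<sigma> x + \<sigma> y" and \<sigma>_smul: "\<sigma> (smul k x) = smul k (\<sigma> x)"
    and \<sigma>_mult: "\<sigma> (x * y) = \<sigma> x * \<sigma> y" and \<sigma>_1: "\<sigma> 1 = 1" and inj: "inj \<sigma>" for x y k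
    using assms(2) by (auto simp: algebra_automorphism_def Vector_Spaces.linear_iff bij_def)
  have "\<sigma> 0 = 0"
    using \<sigma>_add[of 0 0] by simp
  then have \<sigma>_eq_0: "\<sigma> x = 0 \<longleftrightarrow> x = 0" for x
    using inj by (metis injD)
  \<comment> \<open>Applying \<open>\<sigma>\<close> to \<open>x * inverse x = 1\<close> exhibits
    \<open>\<sigma> (inverse x)\<close> as an inverse of \<open>\<sigma> x\<close>.\<close>
  have \<sigma>_inverse: "\<sigma> (inverse x) = inverse (\<sigma> x)" if "x \<noteq> 0" for x
    using that by (metis \<sigma>_1 \<sigma>_mult inverse_unique right_inverse)
  \<comment> \<open>These facts verify that each choice of \<open>\<phi>\<close> is bilinear;
    \<open>c \<noteq> 0\<close> and \<open>\<sigma>_eq_0\<close> make it free of zero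
    divisors.\<close>
  note simps = \<sigma>_add \<sigma>_smul \<sigma>_mult \<sigma>_eq_0 B.mult_smul distrib_left distrib_right \<open>c \<noteq> 0\<close>
  have D: "division_algebra (module_prod.scale smul smul) (D_mult \<sigma> c) \<longleftrightarrow>
      (\<forall>r s t. r \<noteq> 0 \<and> s \<noteq> 0 \<and> t \<noteq> 0 \<longrightarrow> c * \<sigma> (t * s) \<noteq> r * inverse t * r * s)"
    using doubling_division_algebra_iff[OF fd, of "\<lambda>v y. c * \<sigma> (v * y)"]
    by (simp add: simps doubling_mult_def D_mult_def)
  \<comment> \<open>Inversion reverses products, so \<open>\<sigma> (t * s)\<close> has the inverse
    \<open>\<sigma> (inverse s * inverse t)\<close>.\<close>
  have D_iff: "c * \<sigma> (t * s) = r * inverse t * r * s \<longleftrightarrow>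
      c = r * inverse t * r * s * \<sigma> (inverse s * inverse t)" if "s \<noteq> 0" "t \<noteq> 0" for r s t
    using that by (simp add: \<sigma>_eq_0 \<sigma>_inverse \<sigma>_mult mult_eq_iff_eq_mult_inverse nonzero_inverse_mult_distrib)
  have Dm: "division_algebra (module_prod.scale smul smul) (Dm_mult \<sigma> c) \<longleftrightarrow>
      (\<forall>r s t. r \<noteq> 0 \<and> s \<noteq> 0 \<and> t \<noteq> 0 \<longrightarrow> \<sigma> t * c * \<sigma> s \<noteq> r * inverse t * r * s)"
    using doubling_division_algebra_iff[OF fd, of "\<lambda>v y. \<sigma> v * c * \<sigma> y"]
    by (simp add: simps doubling_mult_def Dm_mult_def)
  have Dm_iff: "\<sigma> t * c * \<sigma> s = r * inverse t * r * s \<longleftrightarrow>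
      c = inverse (\<sigma> t) * r * inverse t * r * s * inverse (\<sigma> s)" if "s \<noteq> 0" "t \<noteq> 0" for r s t
    using that by (simp add: \<sigma>_eq_0 mult_eq_iff_eq_mult_inverse mult.assoc)
  have Dr: "division_algebra (module_prod.scale smul smul) (Dr_mult \<sigma> c) \<longleftrightarrow>
      (\<forall>r s t. r \<noteq> 0 \<and> s \<noteq> 0 \<and> t \<noteq> 0 \<longrightarrow> \<sigma> (t * s) * c \<noteq> r * inverse t * r * s)"
    using doubling_division_algebra_iff[OF fd, of "\<lambda>v y. \<sigma> (v * y) * c"]
    by (simp add: simps doubling_mult_def Dr_mult_def)
  have Dr_iff: "\<sigma> (t * s) * c = r * inverse t * r * s \<longleftrightarrow>
      c = \<sigma> (inverse s * inverse t) * r * inverse t * r * s" if "s \<noteq> 0" "t \<noteq> 0" for r s t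
    using that mult_eq_iff_eq_mult_inverse(2)[of "\<sigma> (t * s)" c]
    by (simp add: \<sigma>_eq_0 \<sigma>_inverse \<sigma>_mult nonzero_inverse_mult_distrib mult.assoc)
  \<comment> \<open>The congruence rule makes \<open>s \<noteq> 0\<close> and
    \<open>t \<noteq> 0\<close> available to the conditional equivalences under the
    quantifiers.\<close>
  show ?thesis
    by (simp only: D Dm Dr D_iff Dm_iff Dr_iff simp_thms cong: imp_cong)
qed

end
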